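(* Let $d\in\mathbb{N}$ and $\boldsymbol{\alpha}\in\mathbb{R}^d$. The sequence $(\{n\boldsymbol{\alpha}\})_{n\ge1}$ in $[0,1)^d$ is quasi-uniform if and only if there exists a constant $c>0$ such that $$\langle n\boldsymbol{\alpha}\rangle\ge\frac{c}{n^{1/d}}\qquad\text{for all } n\in\mathbb{N}.$$
   Context: $\{\boldsymbol{x}\}$ denotes the componentwise fractional part of $\boldsymbol{x}\in\mathbb{R}^d$. For $x\in\mathbb{R}$, $\langle x\rangle=\min_{k\in\mathbb{Z}}|x-k|$, and for $\boldsymbol{x}\in\mathbb{R}^d$, $\langle\boldsymbol{x}\rangle=\max_{1\le j\le d}\langle x_j\rangle$. For $p\in[1,\infty]$ and a finite set $P\subset[0,1]^d$ with $|P|\ge2$: $h_p(P)=\sup_{\boldsymbol{x}\in[0,1]^d}\min_{\boldsymbol{y}\in P}\|\boldsymbol{x}-\boldsymbol{y}\|_p$, $q_p(P)=\min_{\boldsymbol{x}\neq\boldsymbol{y}\in P}\|\boldsymbol{x}-\boldsymbol{y}\|_p/2$, $\rho_p(P)=h_p(P)/q_p(P)$. For a sequence of points in $[0,1]^d$ let $P_i$ be the set of its first $i$ points (here $P_i=\{\{\boldsymbol{\alpha}\},\{2\boldsymbol{\alpha}\},\ldots,\{i\boldsymbol{\alpha}\}\}$). The sequence is quasi-uniform if $\sup_i|P_i|=\infty$ and there is a constant $C'_p>0$ with $\rho_p(P_i)\le C'_p$ for all integers $i\ge2$ (by equivalence of norms the property does not depend on $p\in[1,\infty]$). *)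

theory Defs
  imports "HOL-Analysis.Analysis" "HOL-Library.Extended_Nat" "HOL-Library.Extended_Real"
begin

text \<open>Throughout, the dimension $d \ge 1$ is \<open>CARD('d)\<close>.\<close>

definition unit_cube :: "(real ^ 'd) set" where
  "unit_cube = {x. \<forall>j. 0 \<le> x $ j \<and> x $ j \<le> 1}"

definition frac_vec :: "real ^ 'd \<Rightarrow> real ^ 'd" where
  "frac_vec x = (\<chi> j. frac (x $ j))"

definition dist_int :: "real \<Rightarrow> real" where
  "dist_int x = (INF k::int. \<bar>x - of_int k\<bar>)"

definition dist_int_vec :: "real ^ 'd \<Rightarrow> real" where
  "dist_int_vec x = Max (range (\<lambda>j. dist_int (x $ j)))"

text \<open>The $\ell_p$ norm; the exponent is extended real and only meant for \<open>1 \<le> p\<close>.\<close>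

definition lp_norm :: "ereal \<Rightarrow> real ^ 'd \<Rightarrow> real" where
  "lp_norm p x =
     (if p = \<infinity> then Max (range (\<lambda>j. \<bar>x $ j\<bar>))
      else (\<Sum>j\<in>UNIV. \<bar>x $ j\<bar> powr real_of_ereal p) powr (1 / real_of_ereal p))"

text \<open>The next three are only meaningful for finite \<open>P \<subseteq> unit_cube\<close> with \<open>2 \<le> card P\<close>;
  then the sets under \<open>Min\<close> are finite and nonempty and the supremum is that of a bounded set.\<close>

definition covering_radius :: "ereal \<Rightarrow> (real ^ 'd) set \<Rightarrow> real" where
  "covering_radius p P = (SUP x\<in>unit_cube. Min ((\<lambda>y. lp_norm p (x - y)) ` P))"

definition separation_radius :: "ereal \<Rightarrow> (real ^ 'd) set \<Rightarrow> real" where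
  "separation_radius p P = Min {lp_norm p (x - y) | x y. x \<in> P \<and> y \<in> P \<and> x \<noteq> y} / 2"

definition mesh_ratio :: "ereal \<Rightarrow> (real ^ 'd) set \<Rightarrow> real" where
  "mesh_ratio p P = covering_radius p P / separation_radius p P"

text \<open>Sequences are indexed from 1; the value at 0 is irrelevant.\<close>

definition initial_points :: "(nat \<Rightarrow> real ^ 'd) \<Rightarrow> nat \<Rightarrow> (real ^ 'd) set" where
  "initial_points X i = X ` {1..i}"

text \<open>The conjunct \<open>2 \<le> card (initial_points X i)\<close> says that the mesh ratio is defined.\<close>

definition quasi_uniform :: "ereal \<Rightarrow> (nat \<Rightarrow> real ^ 'd) \<Rightarrow> bool" where
  "quasi_uniform p X \<longleftrightarrow>
     (SUP i. enat (card (initial_points X i))) = \<infinity> \<and>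
     (\<exists>C>0. \<forall>i\<ge>2. 2 \<le> card (initial_points X i) \<and> mesh_ratio p (initial_points X i) \<le> C)"

end

theory Submission
  imports Defs
begin

text \<open>All estimates are made in the maximum norm, up to factors \<open>d\<close>.  A pigeonhole argument on
  a grid shows that \<open>i\<close> points have covering radius at least of order \<open>i\<^sup>-\<^sup>1\<^sup>/\<^sup>d\<close>, so a bounded
  mesh ratio forces the separation to be of this order too; comparing the points with indices 1
  and \<open>n + 1\<close> bounds \<open>\<langle>n\<alpha>\<rangle>\<close> from below.  Conversely, the lower bound for \<open>\<langle>n\<alpha>\<rangle>\<close> is a bound for the
  separation, and by a transference argument it also implies that every point of the torus lies
  within order \<open>i\<^sup>-\<^sup>1\<^sup>/\<^sup>d\<close> of one of the first \<open>i\<close> points.\<close>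

section \<open>Distance to the nearest integer; \<open>lp_norm\<close> against the maximum
  norm\<close>

lemma dist_int_round: "dist_int x = \<bar>x - of_int (round x)\<bar>"
  unfolding dist_int_def
proof (rule antisym)
  show "(INF k::int. \<bar>x - of_int k\<bar>) \<le> \<bar>x - of_int (round x)\<bar>"
    by (rule cINF_lower) (auto intro!: bdd_belowI[of _ 0])
  show "\<bar>x - of_int (round x)\<bar> \<le> (INF k::int. \<bar>x - of_int k\<bar>)"
    by (rule cINF_greatest) (auto simp: round_diff_minimal)
qed

text \<open>The infimum is attained at \<open>round\<close>, so maximum and infimum turn into
  quantifiers; negated, this yields a near integer for every coordinate.\<close>

lemma dist_int_vec_ge_iff:
  "B \<le> dist_int_vec x \<longleftrightarrow> (\<exists>j. \<forall>k::int. B \<le> \<bar>x $ j - of_int k\<bar>)"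
proof -
  have "B \<le> dist_int_vec x \<longleftrightarrow> (\<exists>j. B \<le> dist_int (x $ j))"
    unfolding dist_int_vec_def by (subst Max_ge_iff) auto
  also have "\<dots> \<longleftrightarrow> (\<exists>j. \<forall>k::int. B \<le> \<bar>x $ j - of_int k\<bar>)"
    unfolding dist_int_round by (meson order_trans round_diff_minimal)
  finally show ?thesis .
qed

lemma ereal_ge_1_cases:
  assumes "1 \<le> (p::ereal)"
  obtains "p = \<infinity>" | r where "p = ereal r" "1 \<le> r"
  using assms by (cases p) (auto simp: one_ereal_def)

lemma component_le_lp_norm:
  fixes x :: "real ^ 'd"
  assumes "1 \<le> p"
  shows "\<bar>x $ j\<bar> \<le> lp_norm p x"
proof (cases rule: ereal_ge_1_cases[OF assms])
  case 1
  then show ?thesis by (simp add: lp_norm_def)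
next
  case (2 r)
  have "\<bar>x $ j\<bar> = (\<bar>x $ j\<bar> powr r) powr (1 / r)"
    using 2 by (simp add: powr_powr)
  also have "\<dots> \<le> (\<Sum>j\<in>UNIV. \<bar>x $ j\<bar> powr r) powr (1 / r)"
    using 2 by (intro powr_mono2 member_le_sum) auto
  finally show ?thesis using 2 by (simp add: lp_norm_def)
qed

text \<open>For finite exponents the sharp factor is \<open>CARD('d) powr (1 / r)\<close>; the
  cruder \<open>CARD('d)\<close> serves all exponents at once.\<close>

lemma lp_norm_le_card_mult:
  fixes x :: "real ^ 'd"
  assumes "1 \<le> p" and B: "\<And>j. \<bar>x $ j\<bar> \<le> B"
  shows "lp_norm p x \<le> real CARD('d) * B"
proof -
  have "0 \<le> B" using B[of undefined] by linarith
  have d: "1 \<le> real CARD('d)"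
    by (metis One_nat_def Suc_leI of_nat_1 of_nat_mono zero_less_card_finite)
  show ?thesis
  proof (cases rule: ereal_ge_1_cases[OF assms(1)])
    case 1
    have "lp_norm p x \<le> B" using 1 B by (simp add: lp_norm_def)
    also have "\<dots> \<le> real CARD('d) * B" using d \<open>0 \<le> B\<close> by (simp add: mult_le_cancel_right1)
    finally show ?thesis .
  next
    case (2 r)
    have "(\<Sum>j\<in>UNIV. \<bar>x $ j\<bar> powr r) \<le> (\<Sum>j\<in>(UNIV::'d set). B powr r)"
      using 2 B by (intro sum_mono powr_mono2) auto
    also have "\<dots> = real CARD('d) * B powr r" by simp
    finally have "(\<Sum>j\<in>UNIV. \<bar>x $ j\<bar> powr r) powr (1 / r) \<le> (real CARD('d) * B powr r) powr (1 / r)"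
      using 2 by (intro powr_mono2) (auto intro: sum_nonneg)
    also have "\<dots> = real CARD('d) powr (1 / r) * B"
      using 2 \<open>0 \<le> B\<close> by (simp add: powr_mult powr_powr)
    also have "\<dots> \<le> real CARD('d) powr 1 * B"
      using 2 d \<open>0 \<le> B\<close> by (intro mult_right_mono powr_mono) auto
    finally show ?thesis using 2 by (simp add: lp_norm_def)
  qed
qed

section \<open>Covering radius and separation radius of finite point sets\<close>

text \<open>A supremum of reals is an upper bound only for bounded sets; boundedness comes from the
  unit side length of the cube.\<close>

lemma Min_le_covering_radius:
  fixes P :: "(real ^ 'd) set"
  assumes p: "1 \<le> p" and P: "finite P" "P \<noteq> {}" "P \<subseteq> unit_cube" and x: "x \<in> unit_cube"
  shows "Min ((\<lambda>y. lp_norm p (x - y)) ` P) \<le> covering_radius p P"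
  unfolding covering_radius_def
proof (rule cSUP_upper[OF x], rule bdd_aboveI2)
  fix z :: "real ^ 'd" assume z: "z \<in> unit_cube"
  obtain y where y: "y \<in> P" using P by blast
  have "\<bar>(z - y) $ j\<bar> \<le> 1" for j
  proof -
    have "0 \<le> z $ j" "z $ j \<le> 1" "0 \<le> y $ j" "y $ j \<le> 1"
      using z y P by (auto simp: unit_cube_def)
    then show ?thesis by simp
  qed
  then have "lp_norm p (z - y) \<le> real CARD('d) * 1"
    by (rule lp_norm_le_card_mult[OF p])
  then show "Min ((\<lambda>y. lp_norm p (z - y)) ` P) \<le> real CARD('d)"
    using y P by (subst Min_le_iff) auto
qed

text \<open>The minimum over a finite set is attained, and no coordinate exceeds the norm. Later
  arguments can thus be coordinatewise and uniform in \<open>p\<close>.\<close>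

lemma covering_radius_witness:
  fixes P :: "(real ^ 'd) set"
  assumes "1 \<le> p" "finite P" "P \<noteq> {}" "P \<subseteq> unit_cube" "x \<in> unit_cube"
  obtains y where "y \<in> P" "\<And>j. \<bar>x $ j - y $ j\<bar> \<le> covering_radius p P"
proof -
  have "Min ((\<lambda>y. lp_norm p (x - y)) ` P) \<in> (\<lambda>y. lp_norm p (x - y)) ` P"
    using assms by (intro Min_in) auto
  then obtain y where y: "y \<in> P" "lp_norm p (x - y) = Min ((\<lambda>y. lp_norm p (x - y)) ` P)"
    by auto
  show thesis
  proof
    fix j
    show "\<bar>x $ j - y $ j\<bar> \<le> covering_radius p P"
      using component_le_lp_norm[OF assms(1), of "x - y" j] y Min_le_covering_radius[OF assms]
      by simp
  qed fact
qed

lemma covering_radius_le: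
  fixes P :: "(real ^ 'd) set"
  assumes "1 \<le> p" "finite P"
    and "\<And>x. x \<in> unit_cube \<Longrightarrow> \<exists>y\<in>P. \<forall>j. \<bar>x $ j - y $ j\<bar> \<le> B"
  shows "covering_radius p P \<le> real CARD('d) * B"
  unfolding covering_radius_def
proof (rule cSUP_least)
  show "(unit_cube :: (real ^ 'd) set) \<noteq> {}"
    by (auto simp: unit_cube_def intro!: exI[of _ 0])
next
  fix x :: "real ^ 'd" assume "x \<in> unit_cube"
  with assms obtain y where y: "y \<in> P" "\<And>j. \<bar>(x - y) $ j\<bar> \<le> B" by fastforce
  then show "Min ((\<lambda>y. lp_norm p (x - y)) ` P) \<le> real CARD('d) * B"
    using lp_norm_le_card_mult[OF assms(1) y(2)] assms(2) by (subst Min_le_iff) auto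
qed

lemma finite_lp_norm_differences:
  assumes "finite P"
  shows "finite {lp_norm p (x - y) | x y. x \<in> P \<and> y \<in> P \<and> x \<noteq> y}"
  by (rule finite_subset[of _ "(\<lambda>(x, y). lp_norm p (x - y)) ` (P \<times> P)"]) (auto simp: assms)

lemma separation_radius_le:
  assumes "finite P" "x \<in> P" "y \<in> P" "x \<noteq> y"
  shows "2 * separation_radius p P \<le> lp_norm p (x - y)"
proof -
  have "Min {lp_norm p (x - y) | x y. x \<in> P \<and> y \<in> P \<and> x \<noteq> y} \<le> lp_norm p (x - y)"
    using assms by (intro Min_le finite_lp_norm_differences) auto
  then show ?thesis by (simp add: separation_radius_def)
qed

lemma separation_radius_attained:
  assumes "2 \<le> card P"
  obtains x y where "x \<in> P" "y \<in> P" "x \<noteq> y" "separation_radius p P = lp_norm p (x - y) / 2"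
proof -
  let ?D = "{lp_norm p (x - y) | x y. x \<in> P \<and> y \<in> P \<and> x \<noteq> y}"
  have "finite P" using assms by (intro card_ge_0_finite) simp
  moreover have "?D \<noteq> {}" using card_le_Suc0_iff_eq[OF \<open>finite P\<close>] assms by auto
  ultimately have "Min ?D \<in> ?D" by (intro Min_in finite_lp_norm_differences)
  then show thesis using that by (auto simp: separation_radius_def)
qed

lemma separation_radius_pos:
  assumes "1 \<le> p" "2 \<le> card P"
  shows "0 < separation_radius p P"
proof -
  obtain x y where xy: "x \<in> P" "y \<in> P" "x \<noteq> y" "separation_radius p P = lp_norm p (x - y) / 2"
    by (rule separation_radius_attained[OF assms(2)])
  then obtain j where "x $ j \<noteq> y $ j" by (auto simp: vec_eq_iff)
  then show ?thesis using component_le_lp_norm[OF assms(1), of "x - y" j] xy by simp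
qed

section \<open>Pigeonhole arguments on grids\<close>

text \<open>Dirichlet's box principle with \<open>K ^ CARD('d)\<close> half-open cells of side
  \<open>1 / K\<close>. Counting is over the indices in \<open>S\<close>, so \<open>f\<close> may
  repeat values.\<close>

lemma pigeonhole_torus:
  fixes f :: "'a \<Rightarrow> real ^ 'd"
  assumes "K ^ CARD('d) < card S" "0 < K"
  obtains s t where "s \<in> S" "t \<in> S" "s \<noteq> t"
    "\<And>j. \<bar>frac (f s $ j) - frac (f t $ j)\<bar> < 1 / real K"
proof -
  define cell where "cell s = (\<lambda>j. nat \<lfloor>real K * frac (f s $ j)\<rfloor>)" for s
  have "cell s j < K" for s j
  proof -
    have "real K * frac (f s $ j) < real K" using assms by (simp add: frac_lt_1)
    then show ?thesis unfolding cell_def using assms by linarith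
  qed
  then have "cell ` S \<subseteq> PiE UNIV (\<lambda>_. {..<K})" by auto
  then have "card (cell ` S) \<le> card (PiE (UNIV :: 'd set) (\<lambda>_. {..<K}))"
    by (intro card_mono finite_PiE) auto
  then have "card (cell ` S) < card S" using assms by (simp add: card_PiE)
  then have "\<not> inj_on cell S" by (metis card_image less_irrefl)
  then obtain s t where st: "s \<in> S" "t \<in> S" "s \<noteq> t" "cell s = cell t" by (auto simp: inj_on_def)
  have "\<bar>frac (f s $ j) - frac (f t $ j)\<bar> < 1 / real K" for j
  proof -
    have "nat \<lfloor>real K * frac (f s $ j)\<rfloor> = nat \<lfloor>real K * frac (f t $ j)\<rfloor>"
      using st(4) by (metis cell_def)
    moreover have "0 \<le> real K * frac (f s $ j)" "0 \<le> real K * frac (f t $ j)" by auto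
    ultimately have "\<bar>real K * frac (f s $ j) - real K * frac (f t $ j)\<bar> < 1" by linarith
    then have "real K * \<bar>frac (f s $ j) - frac (f t $ j)\<bar> < 1"
      by (simp flip: right_diff_distrib add: abs_mult)
    then show ?thesis using assms by (simp add: field_simps)
  qed
  then show thesis using st that by blast
qed

lemma root_card_power:
  "0 < N \<Longrightarrow> (real N powr (1 / real CARD('d::finite))) ^ CARD('d) = real N"
  by (simp add: powr_powr flip: powr_realpow)

lemma powr_root_le_self:
  assumes "1 \<le> (x::real)"
  shows "x powr (1 / real CARD('d::finite)) \<le> x"
proof -
  have "1 \<le> real CARD('d)"
    by (metis One_nat_def Suc_leI of_nat_1 of_nat_mono zero_less_card_finite)
  then have "x powr (1 / real CARD('d)) \<le> x powr 1"
    using assms by (intro powr_mono) auto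
  then show ?thesis using assms by simp
qed

lemma powr_root_mult_le:
  assumes "1 \<le> (x::real)" "0 \<le> y"
  shows "(x * y) powr (1 / real CARD('d::finite)) \<le> x * y powr (1 / real CARD('d))"
  using assms powr_root_le_self[OF assms(1), where 'd='d] by (simp add: powr_mult mult_right_mono)

text \<open>The \<open>Suc K ^ CARD('d)\<close> grid points of spacing \<open>1 / K\<close>
  outnumber \<open>P\<close>, so two of them are served by the same point of \<open>P\<close>; by
  the triangle inequality they are at most twice the covering radius apart.\<close>

lemma covering_radius_ge:
  fixes P :: "(real ^ 'd) set"
  assumes p: "1 \<le> p" and P: "finite P" "P \<noteq> {}" "P \<subseteq> unit_cube" and "card P \<le> N" "0 < N"
  shows "1 / (2 * real N powr (1 / real CARD('d))) \<le> covering_radius p P"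
proof -
  define e where "e = real N powr (1 / real CARD('d))"
  \<comment> \<open>Rounding down gives both \<open>K \<le> e\<close>, hence spacing at least
    \<open>1 / e\<close>, and \<open>e < Suc K\<close>, hence more than \<open>N\<close> grid
    points.\<close>
  define K where "K = nat \<lfloor>e\<rfloor>"
  have e1: "1 \<le> e" unfolding e_def using \<open>0 < N\<close> by (simp add: ge_one_powr_ge_zero)
  have K: "0 < K" "real K \<le> e" "e < real (Suc K)" using e1 unfolding K_def by linarith+
  have "real N = e ^ CARD('d)" unfolding e_def using root_card_power[OF \<open>0 < N\<close>] by metis
  also have "\<dots> < real (Suc K) ^ CARD('d)" using K e1 by (intro power_strict_mono) auto
  finally have NK: "N < Suc K ^ CARD('d)" by (metis of_nat_less_iff of_nat_power)
  define G where "G = PiE (UNIV :: 'd set) (\<lambda>_. {..K})"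
  define v :: "('d \<Rightarrow> nat) \<Rightarrow> real ^ 'd" where "v g = (\<chi> j. real (g j) / real K)" for g
  have "\<exists>y. y \<in> P \<and> (\<forall>j. \<bar>v g $ j - y $ j\<bar> \<le> covering_radius p P)" if "g \<in> G" for g
  proof -
    have "v g \<in> unit_cube" using that K by (auto simp: unit_cube_def v_def G_def)
    then show ?thesis using covering_radius_witness[OF p P] by metis
  qed
  then obtain y where y: "\<And>g. g \<in> G \<Longrightarrow> y g \<in> P"
    "\<And>g j. g \<in> G \<Longrightarrow> \<bar>v g $ j - y g $ j\<bar> \<le> covering_radius p P"
    by metis
  have "card (y ` G) \<le> card P" using y P by (intro card_mono) auto
  moreover have "card G = Suc K ^ CARD('d)" by (simp add: G_def card_PiE)
  ultimately have "card (y ` G) < card G" using NK \<open>card P \<le> N\<close> by linarith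
  then have "\<not> inj_on y G" by (metis card_image less_irrefl)
  then obtain g g' where g: "g \<in> G" "g' \<in> G" "g \<noteq> g'" "y g = y g'" by (auto simp: inj_on_def)
  then obtain j where j: "g j \<noteq> g' j" by (auto simp: fun_eq_iff)
  have "1 \<le> \<bar>real (g j) - real (g' j)\<bar>" using j by linarith
  then have "1 / real K \<le> \<bar>real (g j) - real (g' j)\<bar> / real K" by (simp add: divide_right_mono)
  also have "\<dots> = \<bar>v g $ j - v g' $ j\<bar>" by (simp add: v_def flip: diff_divide_distrib)
  also have "\<dots> \<le> 2 * covering_radius p P"
    using y(2)[OF g(1), of j, unfolded g(4)] y(2)[OF g(2), of j] by linarith
  finally have "1 / real K \<le> 2 * covering_radius p P" .
  moreover have "1 / e \<le> 1 / real K" using K by (intro divide_left_mono) auto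
  ultimately show ?thesis unfolding e_def by simp
qed

section \<open>Inhomogeneous approximation modulo 1\<close>

lemma frac_vec_in_unit_cube: "frac_vec x \<in> unit_cube"
  by (auto simp: unit_cube_def frac_vec_def less_imp_le[OF frac_lt_1])

lemma frac_diff_int: "\<exists>z::int. frac x - frac y = x - y - of_int z"
  by (rule exI[of _ "\<lfloor>x\<rfloor> - \<lfloor>y\<rfloor>"]) (simp add: frac_def)

text \<open>Transference from homogeneous to inhomogeneous approximation: among the points
  \<open>(k / M) x + n \<alpha>\<close> with \<open>M = h!\<close>, \<open>k \<le> h\<close> and \<open>n < L\<close> two are close modulo 1, and by the
  hypothesis they belong to different \<open>k\<close>.  As the difference of the two values of \<open>k\<close>
  divides \<open>M\<close>, a multiple of that relation approximates \<open>x\<close> itself.\<close>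
lemma inhomogeneous_approximation:
  fixes \<alpha> x :: "real ^ 'd"
  assumes c: "0 < c"
    and bad: "\<And>n. 1 \<le> n \<Longrightarrow> \<exists>j. \<forall>k::int. c / real n powr (1 / real CARD('d)) \<le> \<bar>real n * \<alpha> $ j - of_int k\<bar>"
    and h: "(1 / c + 1) ^ CARD('d) \<le> real h" and L: "1 \<le> L"
  shows "\<exists>q::int. \<bar>q\<bar> \<le> int (fact h * L) \<and> (\<forall>j. \<exists>z::int.
    \<bar>x $ j - of_int q * \<alpha> $ j - of_int z\<bar> < fact h * c / real L powr (1 / real CARD('d)))"
proof -
  define e where "e = real L powr (1 / real CARD('d))"
  define M :: nat where "M = fact h"
  \<comment> \<open>The least \<open>K\<close> with cell width \<open>1 / K\<close> at most
    \<open>c / e\<close>. The size of \<open>h\<close> then keeps the number of cells at most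
    \<open>L * h\<close>, below the number \<open>(h + 1) * L\<close> of pairs.\<close>
  define K where "K = nat \<lceil>e / c\<rceil>"
  have M: "0 < M" by (simp add: M_def)
  have e1: "1 \<le> e" unfolding e_def using L by (simp add: ge_one_powr_ge_zero)
  have "0 < e / c" using e1 c by simp
  then have K: "0 < K" "e / c \<le> real K" "real K \<le> e / c + 1" unfolding K_def by linarith+
  have "real K \<le> e * (1 / c + 1)" using K e1 by (simp add: algebra_simps)
  then have "real K ^ CARD('d) \<le> (e * (1 / c + 1)) ^ CARD('d)" by (intro power_mono) auto
  also have "\<dots> = real L * (1 / c + 1) ^ CARD('d)"
    unfolding e_def power_mult_distrib using root_card_power[of L, where 'd='d] L by simp
  also have "\<dots> \<le> real L * real h" using h by (intro mult_left_mono) auto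
  finally have "K ^ CARD('d) \<le> L * h" by (metis of_nat_le_iff of_nat_mult of_nat_power)
  also have "\<dots> < card ({0..h} \<times> {0..<L})" using L by (simp add: card_cartesian_product)
  finally have card: "K ^ CARD('d) < card ({0..h} \<times> {0..<L})" .
  have Kc: "1 / real K \<le> c / e" using K c e1 by (simp add: field_simps)
  define f where "f s = (real (fst s) / real M) *\<^sub>R x + real (snd s) *\<^sub>R \<alpha>" for s :: "nat \<times> nat"
  \<comment> \<open>With equal \<open>k\<close> the terms in \<open>x\<close> cancel, and all
    coordinates of \<open>(m - n) \<alpha>\<close> would be closer than \<open>c / e\<close> to
    integers, against \<open>bad\<close> since \<open>m - n < L\<close>.\<close>
  have same: False
    if "n < m" "m < L" and near: "\<And>j. \<bar>frac (f (k, n) $ j) - frac (f (k, m) $ j)\<bar> < 1 / real K" for k n m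
  proof -
    obtain j where j: "\<And>z::int. c / real (m - n) powr (1 / real CARD('d)) \<le> \<bar>real (m - n) * \<alpha> $ j - of_int z\<bar>"
      using bad[of "m - n"] \<open>n < m\<close> by (metis Suc_leI One_nat_def zero_less_diff)
    obtain z :: int where z: "frac (f (k, n) $ j) - frac (f (k, m) $ j) = f (k, n) $ j - f (k, m) $ j - of_int z"
      using frac_diff_int by blast
    have "real (m - n) powr (1 / real CARD('d)) \<le> e"
      unfolding e_def using that by (intro powr_mono2) auto
    then have "c / e \<le> c / real (m - n) powr (1 / real CARD('d))"
      using c e1 that by (intro divide_left_mono mult_pos_pos) auto
    also have "\<dots> \<le> \<bar>real (m - n) * \<alpha> $ j - of_int (- z)\<bar>" by (rule j)
    also have "\<dots> = \<bar>frac (f (k, n) $ j) - frac (f (k, m) $ j)\<bar>"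
      unfolding z using that by (simp add: f_def algebra_simps of_nat_diff)
    finally show False using near[of j] Kc by linarith
  qed
  have diff: ?thesis
    if "k < l" "l \<le> h" "n < L" "m < L"
      and near: "\<And>j. \<bar>frac (f (l, n) $ j) - frac (f (k, m) $ j)\<bar> < 1 / real K" for k l n m
  proof -
    have "l - k dvd M" unfolding M_def using that by (intro dvd_fact) auto
    then obtain q where q: "M = (l - k) * q" by blast
    have q0: "0 < q" using q M by (cases q) auto
    have qM: "q \<le> M" using q M by (intro dvd_imp_le) auto
    \<comment> \<open>Multiplying the relation by \<open>q\<close> turns the coefficient
      \<open>(l - k) / M\<close> of \<open>x\<close> into 1 and that of \<alpha> into
      \<open>- r\<close>. The error grows by the factor \<open>q \<le> M\<close>, whence
      \<open>fact h\<close> in the bound.\<close>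
    define r where "r = int q * (int m - int n)"
    have "\<bar>r\<bar> = int q * \<bar>int m - int n\<bar>" by (simp add: r_def abs_mult)
    also have "\<dots> \<le> int M * int L" using that qM by (intro mult_mono) auto
    finally have "\<bar>r\<bar> \<le> int (fact h * L)" by (simp add: M_def)
    moreover have "\<exists>z::int. \<bar>x $ j - of_int r * \<alpha> $ j - of_int z\<bar> < fact h * c / e" for j
    proof -
      obtain z :: int where z: "frac (f (l, n) $ j) - frac (f (k, m) $ j) = f (l, n) $ j - f (k, m) $ j - of_int z"
        using frac_diff_int by blast
      have "real q * (real l - real k) = real M" using q that by (simp add: of_nat_diff mult.commute)
      then have "real q * (real l / real M - real k / real M) = 1" using M by (simp add: field_simps)
      then have x: "real q * (real l / real M * x $ j - real k / real M * x $ j) = x $ j"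
        by (metis left_diff_distrib mult.assoc mult_1)
      have "real q * (f (l, n) $ j - f (k, m) $ j - of_int z)
          = real q * (real l / real M * x $ j - real k / real M * x $ j)
            - of_int r * \<alpha> $ j - of_int (int q * z)"
        by (simp add: f_def r_def algebra_simps)
      then have eq: "x $ j - of_int r * \<alpha> $ j - of_int (int q * z)
          = real q * (frac (f (l, n) $ j) - frac (f (k, m) $ j))"
        unfolding z x by simp
      have "\<bar>x $ j - of_int r * \<alpha> $ j - of_int (int q * z)\<bar> < real q * (1 / real K)"
        unfolding eq abs_mult abs_of_nat using near[of j] q0 by (intro mult_strict_left_mono) auto
      also have "\<dots> \<le> real M * (c / e)" using qM Kc K by (intro mult_mono) auto
      finally show ?thesis by (intro exI[of _ "int q * z"]) (simp add: M_def)
    qed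
    ultimately show ?thesis unfolding e_def by blast
  qed
  obtain s t where st: "s \<in> {0..h} \<times> {0..<L}" "t \<in> {0..h} \<times> {0..<L}" "s \<noteq> t"
    "\<And>j. \<bar>frac (f s $ j) - frac (f t $ j)\<bar> < 1 / real K"
    using pigeonhole_torus[OF card \<open>0 < K\<close>, of f] by metis
  obtain k m l n where kl: "s = (k, m)" "t = (l, n)" by (metis surj_pair)
  have st': "\<bar>frac (f t $ j) - frac (f s $ j)\<bar> < 1 / real K" for j
    using st(4)[of j] by (simp add: abs_minus_commute)
  consider "k < l" | "l < k" | "k = l" "m < n" | "k = l" "n < m" using st(3) kl by fastforce
  then show ?thesis
  proof cases
    case 1
    then show ?thesis using diff[of k l n m] st st' kl by auto
  next
    case 2
    then show ?thesis using diff[of l k m n] st kl by auto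
  next
    case 3
    then show ?thesis using same[of m n k] st kl by auto
  next
    case 4
    then show ?thesis using same[of n m k] st st' kl by auto
  qed
qed

text \<open>The coefficient \<open>q\<close> found before may be negative. Approximating
  \<open>x\<close> minus \<open>M * L + 1\<close> times \<alpha> instead of \<open>x\<close> shifts
  its range to \<open>{1..2 * M * L + 1}\<close>.\<close>

lemma inhomogeneous_approximation_initial:
  fixes \<alpha> :: "real ^ 'd"
  assumes c: "0 < c"
    and bad: "\<And>n. 1 \<le> n \<Longrightarrow> \<exists>j. \<forall>k::int. c / real n powr (1 / real CARD('d)) \<le> \<bar>real n * \<alpha> $ j - of_int k\<bar>"
  obtains H where "0 < H" "\<And>N x. 1 \<le> N \<Longrightarrow> \<exists>n\<in>{1..N}. \<forall>j. \<exists>z::int.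
    \<bar>real n * \<alpha> $ j - x $ j - of_int z\<bar> < H / real N powr (1 / real CARD('d))"
proof -
  obtain h :: nat where h: "(1 / c + 1) ^ CARD('d) \<le> real h" using real_arch_simple by blast
  define M :: nat where "M = fact h"
  have M: "1 \<le> M" by (simp add: M_def)
  \<comment> \<open>The first summand serves \<open>N > 2 * M\<close>, where
    \<open>N \<le> 4 * M * L\<close>. The second makes \<open>H / e\<close> exceed 1/2 for smaller
    \<open>N\<close>, so that already index 1 approximates every \<open>x\<close>.\<close>
  define H where "H = real M * c * (4 * real M) + 2 * real M"
  have H: "0 < H" unfolding H_def using M c by (intro add_pos_pos mult_pos_pos) auto
  have "\<exists>n\<in>{1..N}. \<forall>j. \<exists>z::int. \<bar>real n * \<alpha> $ j - x $ j - of_int z\<bar> < H / real N powr (1 / real CARD('d))"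
    if N: "1 \<le> N" for N and x :: "real ^ 'd"
  proof -
    define e where "e = real N powr (1 / real CARD('d))"
    have e1: "1 \<le> e" unfolding e_def using N by (simp add: ge_one_powr_ge_zero)
    have eN: "e \<le> real N" unfolding e_def using N by (intro powr_root_le_self) auto
    show ?thesis
    proof (cases "N \<le> 2 * M")
      case True
      then have "e \<le> 2 * real M" using eN by linarith
      also have "\<dots> \<le> H" using c by (simp add: H_def)
      finally have "1 / 2 < H / e" using e1 by (simp add: field_simps)
      moreover have "\<bar>y - of_int (round y)\<bar> \<le> 1 / 2" for y :: real
        using of_int_round_abs_le[of y] by (simp add: abs_minus_commute)
      ultimately have "\<bar>real 1 * \<alpha> $ j - x $ j - of_int (round (real 1 * \<alpha> $ j - x $ j))\<bar> < H / e" for j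
        by (meson order_le_less_trans)
      then show ?thesis unfolding e_def using N by (intro bexI[of _ 1]) auto
    next
      case False
      \<comment> \<open>The largest \<open>L\<close> with \<open>2 * M * L + 1 \<le> N\<close>; it
        is still of the order of \<open>N\<close>.\<close>
      define L where "L = (N - 1) div (2 * M)"
      have L1: "1 \<le> L"
        using False M by (simp add: L_def div_greater_zero_iff Suc_le_eq)
      have LN: "2 * M * L + 1 \<le> N"
      proof -
        have "2 * M * L \<le> N - 1" unfolding L_def by (rule times_div_less_eq_dividend)
        then show ?thesis using N by linarith
      qed
      have "N - 1 < 2 * M * L + 2 * M"
        using M dividend_less_times_div[of "2 * M" "N - 1"] by (simp add: L_def)
      also have "\<dots> \<le> 4 * M * L" using L1 by simp
      finally have NL: "N \<le> 4 * M * L" by linarith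
      define l where "l = real L powr (1 / real CARD('d))"
      have l1: "1 \<le> l" unfolding l_def using L1 by (simp add: ge_one_powr_ge_zero)
      have "real N \<le> (4 * real M) * real L" using NL by (metis of_nat_le_iff of_nat_mult of_nat_numeral)
      then have "e \<le> ((4 * real M) * real L) powr (1 / real CARD('d))"
        unfolding e_def by (intro powr_mono2) auto
      also have "\<dots> \<le> 4 * real M * l" unfolding l_def using M by (intro powr_root_mult_le) auto
      finally have "1 / l \<le> 4 * real M / e" using e1 l1 by (simp add: field_simps)
      then have "real M * c * (1 / l) \<le> real M * c * (4 * real M / e)"
        using c by (intro mult_left_mono) auto
      also have "\<dots> \<le> H / e" unfolding H_def using e1 by (simp add: field_simps)
      finally have lH: "fact h * c / l \<le> H / e" by (simp add: M_def)
      obtain q :: int where q: "\<bar>q\<bar> \<le> int (fact h * L)" "\<And>j. \<exists>z::int.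
          \<bar>(x - real (M * L + 1) *\<^sub>R \<alpha>) $ j - of_int q * \<alpha> $ j - of_int z\<bar> < fact h * c / l"
        unfolding l_def
        using inhomogeneous_approximation[OF c bad h L1, of "x - real (M * L + 1) *\<^sub>R \<alpha>"] by blast
      define n where "n = nat (int (M * L + 1) + q)"
      have qML: "\<bar>q\<bar> \<le> int (M * L)" using q(1) by (simp add: M_def)
      then have n: "int n = int (M * L + 1) + q" unfolding n_def by linarith
      then have "int n \<le> 2 * int (M * L) + 1" "1 \<le> int n" using qML by linarith+
      then have "n \<in> {1..N}" using LN unfolding mult.assoc atLeastAtMost_iff by linarith
      moreover have "\<exists>z::int. \<bar>real n * \<alpha> $ j - x $ j - of_int z\<bar> < H / e" for j
      proof -
        obtain z :: int where z: "\<bar>(x - real (M * L + 1) *\<^sub>R \<alpha>) $ j - of_int q * \<alpha> $ j - of_int z\<bar> < fact h * c / l"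
          using q(2) by blast
        have "real n = real (M * L + 1) + of_int q"
          using arg_cong[OF n, of real_of_int] by simp
        then have "real n * \<alpha> $ j - x $ j - of_int (- z)
            = - ((x - real (M * L + 1) *\<^sub>R \<alpha>) $ j - of_int q * \<alpha> $ j - of_int z)"
          by (simp add: algebra_simps)
        then have "\<bar>real n * \<alpha> $ j - x $ j - of_int (- z)\<bar> < H / e" using z lH by linarith
        then show ?thesis by blast
      qed
      ultimately show ?thesis unfolding e_def by blast
    qed
  qed
  then show thesis using that H by blast
qed

section \<open>Badly approximable vectors give quasi-uniform sequences\<close>

lemma frac_eq_diff_int:
  assumes "0 \<le> x - of_int z" "x - of_int z < 1"
  shows "frac x = x - of_int z"
  using assms by (simp add: frac_unique_iff)

text \<open>The hypothesis concerns the torus, the covering radius the cube itself. Passing from one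
  to the other costs the factor 2, and \<open>CARD('d)\<close> accounts for the norm.\<close>

lemma covering_radius_kronecker_le:
  fixes \<alpha> :: "real ^ 'd"
  assumes p: "1 \<le> p" and r: "0 < r"
    and approx: "\<And>x. \<exists>n\<in>{1..N}. \<forall>j. \<exists>z::int. \<bar>real n * \<alpha> $ j - x $ j - of_int z\<bar> < r"
  shows "covering_radius p (initial_points (\<lambda>n. frac_vec (real n *\<^sub>R \<alpha>)) N) \<le> real CARD('d) * (2 * r)"
proof (rule covering_radius_le[OF p])
  show "finite (initial_points (\<lambda>n. frac_vec (real n *\<^sub>R \<alpha>)) N)" by (simp add: initial_points_def)
next
  fix x :: "real ^ 'd" assume x: "x \<in> unit_cube"
  then have x01: "0 \<le> x $ j" "x $ j \<le> 1" for j by (auto simp: unit_cube_def)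
  \<comment> \<open>Moving \<open>x\<close> away from the boundary of the cube turns closeness on the torus into closeness in \<open>\<real>\<^sup>d\<close>.\<close>
  define x' :: "real ^ 'd" where "x' = (\<chi> j. max r (min (1 - r) (x $ j)))"
  obtain n where n: "n \<in> {1..N}" "\<And>j. \<exists>z::int. \<bar>real n * \<alpha> $ j - x' $ j - of_int z\<bar> < r"
    using approx by blast
  have "\<bar>x $ j - frac (real n * \<alpha> $ j)\<bar> \<le> 2 * r" for j
  proof (cases "r \<le> 1 / 2")
    case True
    obtain z :: int where z: "\<bar>real n * \<alpha> $ j - x' $ j - of_int z\<bar> < r" using n by blast
    have x': "r \<le> x' $ j" "x' $ j \<le> 1 - r" "\<bar>x $ j - x' $ j\<bar> \<le> r"
      using True x01[of j] r by (auto simp: x'_def)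
    have "frac (real n * \<alpha> $ j) = real n * \<alpha> $ j - of_int z"
      using z x' by (intro frac_eq_diff_int) linarith+
    then show ?thesis using z x' by linarith
  next
    \<comment> \<open>Here \<open>2 * r\<close> exceeds the side length of the cube, so any point
      will do.\<close>
    case False
    then show ?thesis using x01[of j] frac_ge_0[of "real n * \<alpha> $ j"] frac_lt_1[of "real n * \<alpha> $ j"] by linarith
  qed
  then show "\<exists>y\<in>initial_points (\<lambda>n. frac_vec (real n *\<^sub>R \<alpha>)) N. \<forall>j. \<bar>x $ j - y $ j\<bar> \<le> 2 * r"
    unfolding initial_points_def using n(1)
    by (intro bexI[of _ "frac_vec (real n *\<^sub>R \<alpha>)"]) (auto simp: frac_vec_def)
qed

lemma quasi_uniform_if_badly_approximable:
  fixes \<alpha> :: "real ^ 'd"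
  assumes p: "1 \<le> p" and c: "0 < c"
    and "\<And>n. 1 \<le> n \<Longrightarrow> c / real n powr (1 / real CARD('d)) \<le> dist_int_vec (real n *\<^sub>R \<alpha>)"
  shows "quasi_uniform p (\<lambda>n. frac_vec (real n *\<^sub>R \<alpha>))"
proof -
  define X where "X n = frac_vec (real n *\<^sub>R \<alpha>)" for n
  have bad: "\<exists>j. \<forall>k::int. c / real n powr (1 / real CARD('d)) \<le> \<bar>real n * \<alpha> $ j - of_int k\<bar>" if "1 \<le> n" for n
    using assms(3)[OF that] by (simp add: dist_int_vec_ge_iff)
  \<comment> \<open>The two points differ by \<open>n - m\<close> times \<alpha> up to an integer
    vector, and \<open>n - m \<le> N\<close> makes the bound uniform over the first \<open>N\<close>
    points.\<close>
  have sep': "c / real N powr (1 / real CARD('d)) \<le> lp_norm p (X n - X m)"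
    if nm: "m < n" "n \<le> N" for n m N
  proof -
    obtain j where j: "\<And>z::int. c / real (n - m) powr (1 / real CARD('d)) \<le> \<bar>real (n - m) * \<alpha> $ j - of_int z\<bar>"
      using bad[of "n - m"] nm(1) by (metis Suc_leI One_nat_def zero_less_diff)
    obtain z :: int where z: "frac (real n * \<alpha> $ j) - frac (real m * \<alpha> $ j) = real n * \<alpha> $ j - real m * \<alpha> $ j - of_int z"
      using frac_diff_int by blast
    have "real (n - m) powr (1 / real CARD('d)) \<le> real N powr (1 / real CARD('d))"
      using nm by (intro powr_mono2) auto
    then have "c / real N powr (1 / real CARD('d)) \<le> c / real (n - m) powr (1 / real CARD('d))"
      using c nm by (intro divide_left_mono mult_pos_pos) auto
    also have "\<dots> \<le> \<bar>real (n - m) * \<alpha> $ j - of_int z\<bar>" by (rule j)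
    also have "\<dots> = \<bar>(X n - X m) $ j\<bar>"
      using z nm by (simp add: X_def frac_vec_def algebra_simps of_nat_diff)
    also have "\<dots> \<le> lp_norm p (X n - X m)" by (rule component_le_lp_norm[OF p])
    finally show ?thesis .
  qed
  have lp_commute: "lp_norm p (x - y) = lp_norm p (y - x)" for x y :: "real ^ 'd"
    by (simp add: lp_norm_def abs_minus_commute)
  have sep: "c / real N powr (1 / real CARD('d)) \<le> lp_norm p (X n - X m)"
    if "m \<noteq> n" "n \<le> N" "m \<le> N" for n m N
    using that sep'[of m n N] sep'[of n m N] lp_commute[of "X n" "X m"] by (cases "m < n") auto
  \<comment> \<open>Coinciding points would have distance 0. Injectivity yields exactly
    \<open>N\<close> initial points, hence both the unbounded cardinality and the existence of the
    mesh ratio.\<close>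
  have inj: "inj_on X {1..N}" for N
  proof (rule linorder_inj_onI', rule notI)
    fix m n assume mn: "m < n" "m \<in> {1..N}" "X m = X n"
    have "0 < c / real n powr (1 / real CARD('d))" using c mn by simp
    also have "\<dots> \<le> lp_norm p (X n - X m)" using mn by (intro sep') auto
    also have "\<dots> \<le> real CARD('d) * 0" using mn by (intro lp_norm_le_card_mult[OF p]) auto
    finally show False by simp
  qed
  have card: "card (initial_points X N) = N" for N
    unfolding initial_points_def using card_image[OF inj[of N]] by simp
  obtain H where H: "0 < H" "\<And>N x. 1 \<le> N \<Longrightarrow> \<exists>n\<in>{1..N}. \<forall>j. \<exists>z::int.
      \<bar>real n * \<alpha> $ j - x $ j - of_int z\<bar> < H / real N powr (1 / real CARD('d))"
    using inhomogeneous_approximation_initial[OF c bad] by metis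
  have d: "0 < real CARD('d)" by simp
  \<comment> \<open>Quotient of the covering bound \<open>2 * CARD('d) * H / e\<close> by the
    separation bound \<open>c / (2 * e)\<close>.\<close>
  define C where "C = 4 * real CARD('d) * H / c"
  have "mesh_ratio p (initial_points X N) \<le> C" if N: "2 \<le> N" for N
  proof -
    define e where "e = real N powr (1 / real CARD('d))"
    have e: "0 < e" using N by (simp add: e_def)
    have h: "covering_radius p (initial_points X N) \<le> real CARD('d) * (2 * (H / e))"
      unfolding X_def e_def using N H by (intro covering_radius_kronecker_le[OF p]) auto
    obtain x y where xy: "x \<in> initial_points X N" "y \<in> initial_points X N" "x \<noteq> y"
      "separation_radius p (initial_points X N) = lp_norm p (x - y) / 2"
      using separation_radius_attained[of "initial_points X N" p] card N by metis
    obtain n m where "x = X n" "y = X m" "n \<in> {1..N}" "m \<in> {1..N}"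
      using xy(1,2) unfolding initial_points_def by blast
    then have "x = X n" "y = X m" "n \<le> N" "m \<le> N" "m \<noteq> n" using xy(3) by auto
    then have q: "c / e / 2 \<le> separation_radius p (initial_points X N)"
      unfolding xy e_def using sep by simp
    have "covering_radius p (initial_points X N) / separation_radius p (initial_points X N)
        \<le> (real CARD('d) * (2 * (H / e))) / (c / e / 2)"
      using h q c e H(1) by (intro frac_le) auto
    also have "\<dots> = C" using e c by (simp add: C_def field_simps)
    finally show ?thesis by (simp add: mesh_ratio_def)
  qed
  moreover have "0 < C" using H(1) c by (simp add: C_def)
  moreover have "(SUP i. enat (card (initial_points X i))) = \<infinity>"
  proof (rule ccontr)
    assume "(SUP i. enat (card (initial_points X i))) \<noteq> \<infinity>"
    then obtain n where "(SUP i. enat (card (initial_points X i))) = enat n" by auto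
    then have "enat (card (initial_points X (Suc n))) \<le> enat n" by (metis SUP_upper UNIV_I)
    then show False by (simp add: card)
  qed
  ultimately show ?thesis unfolding quasi_uniform_def card X_def[symmetric] by auto
qed

section \<open>Quasi-uniformity forces bad approximability\<close>

lemma frac_vec_eq_add:
  assumes "frac_vec x = frac_vec y"
  shows "frac_vec (x + z) = frac_vec (y + z)"
proof -
  have "frac (x $ j + z $ j) = frac (y $ j + z $ j)" for j
  proof -
    have "frac (x $ j) = frac (y $ j)" using assms by (simp add: frac_vec_def vec_eq_iff)
    then show ?thesis by (simp add: frac_add)
  qed
  then show ?thesis by (simp add: frac_vec_def vec_eq_iff)
qed

text \<open>Two equal points would make the sequence periodic with period \<open>n - m\<close> from
  index \<open>m\<close> on, leaving at most \<open>n\<close> values.\<close>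

lemma kronecker_inj:
  fixes \<alpha> :: "real ^ 'd"
  assumes unbounded: "(SUP i. enat (card (initial_points (\<lambda>n. frac_vec (real n *\<^sub>R \<alpha>)) i))) = \<infinity>"
    and mn: "1 \<le> m" "m < n"
  shows "frac_vec (real m *\<^sub>R \<alpha>) \<noteq> frac_vec (real n *\<^sub>R \<alpha>)"
proof
  define X where "X n = frac_vec (real n *\<^sub>R \<alpha>)" for n
  assume "frac_vec (real m *\<^sub>R \<alpha>) = frac_vec (real n *\<^sub>R \<alpha>)"
  then have period: "X (m + k) = X (n + k)" for k
    using frac_vec_eq_add[of "real m *\<^sub>R \<alpha>" "real n *\<^sub>R \<alpha>" "real k *\<^sub>R \<alpha>"]
    by (simp add: X_def scaleR_left_distrib)
  have "X k \<in> X ` {1..n}" if "1 \<le> k" for k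
    using that
  proof (induction k rule: less_induct)
    case (less k)
    show ?case
    proof (cases "k \<le> n")
      case False
      then have "X k = X (m + (k - n))" using period[of "k - n"] by simp
      then show ?thesis using less.IH[of "m + (k - n)"] False mn by simp
    qed (use less in auto)
  qed
  then have "initial_points X i \<subseteq> X ` {1..n}" for i by (auto simp: initial_points_def)
  then have "card (initial_points X i) \<le> card (X ` {1..n})" for i by (intro card_mono) auto
  moreover have "card (X ` {1..n}) \<le> n" using card_image_le[of "{1..n}" X] by simp
  ultimately have "card (initial_points X i) \<le> n" for i using order_trans by blast
  then have "(SUP i. enat (card (initial_points X i))) \<le> enat n" by (intro SUP_least) simp
  then show False using unbounded unfolding X_def[symmetric] by simp
qed

text \<open>Distances are measured in the cube, not on the torus, so a small distance of
  \<open>n\<close> times \<alpha> to the integers makes points 1 and \<open>n + 1\<close> close only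
  if no coordinate wraps around. Hence the coordinates of \<alpha> are first shown to be
  non-integral.\<close>

lemma badly_approximable_if_quasi_uniform:
  fixes \<alpha> :: "real ^ 'd"
  assumes p: "1 \<le> p" and qu: "quasi_uniform p (\<lambda>n. frac_vec (real n *\<^sub>R \<alpha>))"
  shows "\<exists>c>0. \<forall>n\<ge>1. c / real n powr (1 / real CARD('d)) \<le> dist_int_vec (real n *\<^sub>R \<alpha>)"
proof -
  define X where "X n = frac_vec (real n *\<^sub>R \<alpha>)" for n
  define d where "d = real CARD('d)"
  have d: "0 < d" by (simp add: d_def)
  have X: "X n $ j = frac (real n * \<alpha> $ j)" for n j by (simp add: X_def frac_vec_def)
  obtain C where C: "0 < C" "\<And>i. 2 \<le> i \<Longrightarrow> 2 \<le> card (initial_points X i)"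
    "\<And>i. 2 \<le> i \<Longrightarrow> mesh_ratio p (initial_points X i) \<le> C"
    using qu unfolding quasi_uniform_def X_def[symmetric] by auto
  have inj: "X m \<noteq> X n" if "1 \<le> m" "1 \<le> n" "m \<noteq> n" for m n
    using qu kronecker_inj[of \<alpha> m n] kronecker_inj[of \<alpha> n m] that
    by (cases "m < n") (auto simp: quasi_uniform_def X_def)
  have P: "finite (initial_points X i)" "initial_points X i \<subseteq> unit_cube" for i
    by (auto simp: initial_points_def X_def frac_vec_in_unit_cube)
  \<comment> \<open>A close pair bounds the separation radius from above, and the bounded mesh ratio
    passes this on to the covering radius.\<close>
  have sep: "2 * covering_radius p (initial_points X i) \<le> C * (d * B)"
    if "2 \<le> i" "m \<in> {1..i}" "n \<in> {1..i}" "m \<noteq> n" "\<And>j. \<bar>X m $ j - X n $ j\<bar> \<le> B" for i m n B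
  proof -
    have "covering_radius p (initial_points X i) \<le> C * separation_radius p (initial_points X i)"
      using C(3)[OF that(1)] separation_radius_pos[OF p C(2)[OF that(1)]]
      by (simp add: mesh_ratio_def divide_le_eq)
    moreover have "2 * separation_radius p (initial_points X i) \<le> lp_norm p (X m - X n)"
      using that inj by (intro separation_radius_le P) (auto simp: initial_points_def)
    moreover have "lp_norm p (X m - X n) \<le> d * B"
      unfolding d_def using that by (intro lp_norm_le_card_mult[OF p]) auto
    ultimately have "2 * separation_radius p (initial_points X i) \<le> d * B" by linarith
    then have "C * (2 * separation_radius p (initial_points X i)) \<le> C * (d * B)"
      using C(1) by (intro mult_left_mono) auto
    then show ?thesis
      using \<open>covering_radius p (initial_points X i) \<le> C * separation_radius p (initial_points X i)\<close>
      by linarith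
  qed
  \<comment> \<open>If \<open>\<alpha>\<^sub>j\<close> were an integer, all points would lie on the face \<open>x\<^sub>j = 0\<close>, so the covering radii
    would stay above 1 although the separation radii tend to 0.\<close>
  have frac_pos: "0 < frac (\<alpha> $ j)" for j
  proof (rule ccontr)
    assume "\<not> 0 < frac (\<alpha> $ j)"
    then have "\<alpha> $ j \<in> \<int>" by (metis frac_gt_0_iff)
    then have Xj: "X n $ j = 0" for n by (simp add: X frac_eq_0_iff)
    \<comment> \<open>Large enough for a pair at distance at most \<open>1 / K\<close> to push the
      covering radius below 1 through \<open>sep\<close>.\<close>
    obtain K :: nat where K: "C * d < real K" using reals_Archimedean2 by blast
    then have K0: "0 < K" using C(1) d by (metis mult_pos_pos of_nat_0_less_iff order_less_trans)
    define i where "i = K ^ CARD('d) + 1"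
    have i: "2 \<le> i" using K0 by (simp add: i_def Suc_le_eq)
    obtain m n where mn: "m \<in> {1..i}" "n \<in> {1..i}" "m \<noteq> n"
      "\<And>j. \<bar>frac ((real m *\<^sub>R \<alpha>) $ j) - frac ((real n *\<^sub>R \<alpha>) $ j)\<bar> < 1 / real K"
      using pigeonhole_torus[OF _ K0, of "{1..i}" "\<lambda>n. real n *\<^sub>R \<alpha>"] by (auto simp: i_def)
    have "\<bar>X m $ j - X n $ j\<bar> \<le> 1 / real K" for j using mn(4)[of j] by (simp add: X)
    then have "2 * covering_radius p (initial_points X i) \<le> C * (d * (1 / real K))"
      using sep i mn by blast
    also have "\<dots> < 1" using K K0 by (simp add: field_simps)
    finally have "covering_radius p (initial_points X i) < 1" by simp
    moreover have "(\<chi> j. 1) \<in> (unit_cube :: (real ^ 'd) set)" by (simp add: unit_cube_def)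
    moreover have "initial_points X i \<noteq> {}" using i by (simp add: initial_points_def)
    ultimately obtain y where "y \<in> initial_points X i" "\<bar>(\<chi> j. 1) $ j - y $ j\<bar> < 1"
      using covering_radius_witness[OF p P(1)[of i] _ P(2)[of i]] by (metis order_le_less_trans)
    then show False using Xj by (auto simp: initial_points_def)
  qed
  define \<epsilon> where "\<epsilon> = Min (range (\<lambda>j. min (frac (\<alpha> $ j)) (1 - frac (\<alpha> $ j))))"
  have \<epsilon>: "0 < \<epsilon>" unfolding \<epsilon>_def using frac_pos by (subst Min_gr_iff) (auto simp: frac_lt_1)
  have \<epsilon>_le: "\<epsilon> \<le> frac (\<alpha> $ j)" "\<epsilon> \<le> 1 - frac (\<alpha> $ j)" for j
  proof -
    have "\<epsilon> \<le> min (frac (\<alpha> $ j)) (1 - frac (\<alpha> $ j))" unfolding \<epsilon>_def by (rule Min_le) auto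
    then show "\<epsilon> \<le> frac (\<alpha> $ j)" "\<epsilon> \<le> 1 - frac (\<alpha> $ j)" by auto
  qed
  \<comment> \<open>The bound by \<epsilon> rules out wrapping around at the first point; the other
    one is tuned so that the final chain leads from \<open>1 / (2 * e)\<close> strictly back to
    itself.\<close>
  define c where "c = min \<epsilon> (1 / (2 * C * d))"
  have c: "0 < c" using \<epsilon> C(1) d by (simp add: c_def)
  have "c / real n powr (1 / real CARD('d)) \<le> dist_int_vec (real n *\<^sub>R \<alpha>)" if n: "1 \<le> n" for n
  proof (rule ccontr)
    define e where "e = real n powr (1 / real CARD('d))"
    have e1: "1 \<le> e" unfolding e_def using n by (simp add: ge_one_powr_ge_zero)
    assume "\<not> ?thesis"
    then have near: "\<exists>z::int. \<bar>real n * \<alpha> $ j - of_int z\<bar> < c / e" for j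
      by (simp add: dist_int_vec_ge_iff e_def not_le)
    \<comment> \<open>The first point lies at distance at least \<open>\<epsilon>\<close> from the boundary of the cube, so the
      torus translation by \<open>n\<alpha>\<close> does not wrap around there.\<close>
    define B where "B = Max (range (\<lambda>j. \<bar>X (n + 1) $ j - X 1 $ j\<bar>))"
    have ce: "c / e \<le> \<epsilon>"
    proof -
      have "c / e \<le> c / 1" using c e1 by (intro divide_left_mono) auto
      then show ?thesis by (simp add: c_def)
    qed
    have "\<bar>X (n + 1) $ j - X 1 $ j\<bar> < c / e" for j
    proof -
      obtain z :: int where z: "\<bar>real n * \<alpha> $ j - of_int z\<bar> < c / e" using near by blast
      have split: "real (n + 1) * \<alpha> $ j - of_int (z + \<lfloor>\<alpha> $ j\<rfloor>) = (real n * \<alpha> $ j - of_int z) + frac (\<alpha> $ j)"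
        by (simp add: frac_def algebra_simps)
      have "frac (real (n + 1) * \<alpha> $ j) = (real n * \<alpha> $ j - of_int z) + frac (\<alpha> $ j)"
        unfolding split[symmetric]
        by (rule frac_eq_diff_int; unfold split) (use z ce \<epsilon>_le[of j] in linarith)+
      then show ?thesis using z by (simp add: X)
    qed
    \<comment> \<open>A maximum over finitely many coordinates keeps the strict inequality, which
      the final chain needs.\<close>
    then have B: "B < c / e" by (simp add: B_def)
    have "\<bar>X (n + 1) $ j - X 1 $ j\<bar> \<le> B" for j by (simp add: B_def)
    then have up: "2 * covering_radius p (initial_points X (n + 1)) \<le> C * (d * B)"
      using n by (intro sep[of "n + 1" "n + 1" 1]) auto
    have "card (initial_points X (n + 1)) \<le> n + 1"
      unfolding initial_points_def using card_image_le[of "{1..n + 1}" X] by simp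
    then have low: "1 / (2 * real (n + 1) powr (1 / real CARD('d))) \<le> covering_radius p (initial_points X (n + 1))"
      by (intro covering_radius_ge[OF p P(1) _ P(2)]) (auto simp: initial_points_def)
    \<comment> \<open>Through \<open>n + 1 \<le> 2 * n\<close> the covering bound for
      \<open>n + 1\<close> points is expressed by \<open>e\<close>, which belongs to
      \<open>n\<close>.\<close>
    have "real (n + 1) powr (1 / real CARD('d)) \<le> (2 * real n) powr (1 / real CARD('d))"
      using n by (intro powr_mono2) auto
    also have "\<dots> \<le> 2 * e" unfolding e_def by (intro powr_root_mult_le) auto
    finally have "1 / (2 * e) \<le> 1 / real (n + 1) powr (1 / real CARD('d))"
      using e1 by (intro divide_left_mono mult_pos_pos) auto
    also have "\<dots> \<le> 2 * covering_radius p (initial_points X (n + 1))" using low by simp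
    also note up
    also have "C * (d * B) < C * (d * (c / e))" using B C(1) d by (intro mult_strict_left_mono)
    also have "\<dots> \<le> C * (d * (1 / (2 * C * d) / e))"
      using C(1) d e1 by (intro mult_left_mono divide_right_mono) (auto simp: c_def)
    also have "\<dots> = 1 / (2 * e)" using C(1) d by simp
    finally show False by simp
  qed
  then show ?thesis using c by blast
qed

theorem theorem3p9:
  fixes \<alpha> :: "real ^ 'd" and p :: ereal
  assumes "1 \<le> p"
  shows "quasi_uniform p (\<lambda>n. frac_vec (real n *\<^sub>R \<alpha>)) \<longleftrightarrow>
    (\<exists>c>0. \<forall>n\<ge>1. dist_int_vec (real n *\<^sub>R \<alpha>) \<ge> c / real n powr (1 / real CARD('d)))"
  using badly_approximable_if_quasi_uniform[OF assms] quasi_uniform_if_badly_approximable[OF assms]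
  by blast

end
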